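(* Let $\mathcal{H}$ be a complex Hilbert space and $d\in\mathbb{N}$. Let $\mathbf{T}=\mathbf{V}P=(V_1P,\ldots,V_dP)$ be the spherical polar decomposition of a pure spherically quasinormal $d$-tuple $\mathbf{T}\in\mathfrak{B}(\mathcal{H})^d$, and let $\mathbf{N}\in\mathfrak{B}(\mathcal{K})^d$, $\mathcal{K}\supseteq\mathcal{H}$, be the minimal normal extension of $\mathbf{T}$. If $\mathbf{N}=\mathbf{W}R=(W_1R,\ldots,W_dR)$ is the spherical polar decomposition of $\mathbf{N}$, then $\mathbf{V}=P_{\mathcal{H}}^{cr}\mathbf{W}\restriction_{\mathcal{H}}$ (that is, $V_k=P_{\mathcal{H}}^{cr}W_k\restriction_{\mathcal{H}}$ for every $k\in\{1,\ldots,d\}$) and $P=P_{\mathcal{H}}^{cr}R\restriction_{\mathcal{H}}$.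
   Context: $\mathfrak{B}(\mathcal{H})$ is the algebra of bounded linear operators on $\mathcal{H}$; $\mathcal{N}(\cdot)$ denotes the null space. $P_{\mathcal{H}}$ is the orthogonal projection of $\mathcal{K}$ onto $\mathcal{H}$, and $P_{\mathcal{H}}^{cr}:\mathcal{K}\to\mathcal{H}$ is its corestriction to its range $\mathcal{H}$; so $P_{\mathcal{H}}^{cr}A\restriction_{\mathcal{H}}\in\mathfrak{B}(\mathcal{H})$ is the compression of $A\in\mathfrak{B}(\mathcal{K})$ to $\mathcal{H}$. $\mathbf{T}=(T_1,\ldots,T_d)\in\mathfrak{B}(\mathcal{H})^d$ is spherically quasinormal if each $T_i$ commutes with $\sum_{j=1}^dT_j^*T_j$. A $d$-tuple is normal if it is commuting and each of its entries is a normal operator. $\mathbf{T}$ is pure if there is no non-zero closed subspace $\mathcal{M}\subseteq\mathcal{H}$ that reduces every $T_k$ and for which the compressions (restrictions) of $T_1,\ldots,T_d$ to $\mathcal{M}$ form a normal $d$-tuple on $\mathcal{M}$. A normal extension of $\mathbf{T}$ is a normal $d$-tuple $\mathbf{N}=(N_1,\ldots,N_d)\in\mathfrak{B}(\mathcal{K})^d$ on a Hilbert space $\mathcal{K}\supseteq\mathcal{H}$ with $N_k\mathcal{H}\subseteq\mathcal{H}$ and $N_k|_{\mathcal{H}}=T_k$ for every $k$; it is the minimal normal extension if no proper closed subspace of $\mathcal{K}$ containing $\mathcal{H}$ reduces every $N_k$. Spherical polar decomposition of a $d$-tuple $\mathbf{A}=(A_1,\ldots,A_d)$ on a Hilbert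 space $\mathcal{L}$: regard $\mathbf{A}$ as the column operator $\mathcal{L}\to\mathcal{L}^d$, $x\mapsto(A_1x,\ldots,A_dx)$. Then $\mathbf{A}=\mathbf{U}Q=(U_1Q,\ldots,U_dQ)$, where $Q=\sqrt{A_1^*A_1+\cdots+A_d^*A_d}$ and $\mathbf{U}=(U_1,\ldots,U_d)$, regarded as a column operator, is a partial isometry $\mathcal{L}\to\mathcal{L}^d$ with initial space $\left(\bigcap_k\mathcal{N}(A_k)\right)^\perp=\mathcal{N}(Q)^\perp=\left(\bigcap_k\mathcal{N}(U_k)\right)^\perp$. *)

theory Defs
  imports "HOL-Analysis.Analysis"
begin

text \<open>
  Complex Hilbert spaces. The underlying real Hilbert space (whose norm is
  \<open>sqrt (inner x x)\<close>) is the library's; its inner product is the real part of the complex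
  one, so positive definiteness of \<open>cinner\<close> and the identity
  \<open>norm x ^ 2 = cinner x x\<close> come from \<open>real_inner\<close>. The inner product is linear in the
  first argument.
\<close>

class complex_hilbert = real_inner + complete_space +
  fixes scaleC :: "complex \<Rightarrow> 'a \<Rightarrow> 'a"  (infixr "*\<^sub>C" 75)
    and cinner :: "'a \<Rightarrow> 'a \<Rightarrow> complex"
  assumes scaleC_add_right: "a *\<^sub>C (x + y) = a *\<^sub>C x + a *\<^sub>C y"
    and scaleC_add_left: "(a + b) *\<^sub>C x = a *\<^sub>C x + b *\<^sub>C x"
    and scaleC_scaleC: "a *\<^sub>C (b *\<^sub>C x) = (a * b) *\<^sub>C x"
    and scaleC_of_real: "complex_of_real r *\<^sub>C x = r *\<^sub>R x"
    and cinner_add_left: "cinner (x + y) z = cinner x z + cinner y z"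
    and cinner_scaleC_left: "cinner (a *\<^sub>C x) y = a * cinner x y"
    and cinner_commute: "cinner x y = cnj (cinner y x)"
    and Re_cinner: "Re (cinner x y) = inner x y"

instantiation complex :: complex_hilbert
begin

definition scaleC_complex_def: "scaleC (a :: complex) (x :: complex) = a * x"
definition cinner_complex_def: "cinner (x :: complex) (y :: complex) = x * cnj y"

instance
  by standard
    (simp_all add: scaleC_complex_def cinner_complex_def algebra_simps
      scaleR_conv_of_real inner_complex_def)

end

text \<open>
  A Hilbert space is represented by a closed subspace \<open>S\<close> of an ambient complex Hilbert space
  (possibly all of it), and an operator on \<open>S\<close> by a function whose values outside \<open>S\<close> are
  irrelevant. Adjoints and orthogonal complements are relative to \<open>S\<close>, so an operator and its
  restriction to an invariant subspace are given by the same function and differ only in the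
  carrier.
\<close>

definition closed_csubspace :: "'a::complex_hilbert set \<Rightarrow> bool" where
  "closed_csubspace S \<longleftrightarrow> closed S \<and> 0 \<in> S \<and>
     (\<forall>x\<in>S. \<forall>y\<in>S. x + y \<in> S) \<and> (\<forall>a. \<forall>x\<in>S. a *\<^sub>C x \<in> S)"

definition ocompl :: "'a::complex_hilbert set \<Rightarrow> 'a set \<Rightarrow> 'a set" where
  "ocompl S M = {x \<in> S. \<forall>y\<in>M. cinner x y = 0}"

text \<open>As a map into \<open>S\<close>, this is the corestriction of the orthogonal projection onto \<open>S\<close>.\<close>

definition oproj :: "'a::complex_hilbert set \<Rightarrow> 'a \<Rightarrow> 'a" where
  "oproj S x = (THE y. y \<in> S \<and> (\<forall>z\<in>S. cinner (x - y) z = 0))"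

definition bounded_op_on :: "'a::complex_hilbert set \<Rightarrow> ('a \<Rightarrow> 'a) \<Rightarrow> bool" where
  "bounded_op_on S A \<longleftrightarrow>
     (\<forall>x\<in>S. A x \<in> S) \<and>
     (\<forall>x\<in>S. \<forall>y\<in>S. A (x + y) = A x + A y) \<and>
     (\<forall>a. \<forall>x\<in>S. A (a *\<^sub>C x) = a *\<^sub>C A x) \<and>
     (\<exists>C. \<forall>x\<in>S. norm (A x) \<le> C * norm x)"

text \<open>For a bounded operator on a closed subspace \<open>S\<close>, such a \<open>B\<close> exists and is unique on \<open>S\<close>.\<close>

definition adjoint_on :: "'a::complex_hilbert set \<Rightarrow> ('a \<Rightarrow> 'a) \<Rightarrow> 'a \<Rightarrow> 'a" where
  "adjoint_on S A = (SOME B. (\<forall>y\<in>S. B y \<in> S) \<and>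
     (\<forall>x\<in>S. \<forall>y\<in>S. cinner (A x) y = cinner x (B y)))"

definition positive_op_on :: "'a::complex_hilbert set \<Rightarrow> ('a \<Rightarrow> 'a) \<Rightarrow> bool" where
  "positive_op_on S Q \<longleftrightarrow> bounded_op_on S Q \<and> (\<forall>x\<in>S. cinner (Q x) x \<in> \<real>\<^sub>\<ge>\<^sub>0)"

definition sqrt_op_on :: "'a::complex_hilbert set \<Rightarrow> ('a \<Rightarrow> 'a) \<Rightarrow> ('a \<Rightarrow> 'a) \<Rightarrow> bool" where
  "sqrt_op_on S B Q \<longleftrightarrow> positive_op_on S Q \<and> (\<forall>x\<in>S. Q (Q x) = B x)"

definition null_on :: "'a::complex_hilbert set \<Rightarrow> ('a \<Rightarrow> 'a) \<Rightarrow> 'a set" where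
  "null_on S A = {x \<in> S. A x = 0}"

text \<open>A \<open>d\<close>-tuple \<open>A\<close> is indexed by \<open>{1..d}\<close>; other indices are irrelevant.\<close>

definition op_tuple_on :: "'a::complex_hilbert set \<Rightarrow> nat \<Rightarrow> (nat \<Rightarrow> 'a \<Rightarrow> 'a) \<Rightarrow> bool" where
  "op_tuple_on S d A \<longleftrightarrow> (\<forall>k\<in>{1..d}. bounded_op_on S (A k))"

definition sum_adj_on ::
  "'a::complex_hilbert set \<Rightarrow> nat \<Rightarrow> (nat \<Rightarrow> 'a \<Rightarrow> 'a) \<Rightarrow> 'a \<Rightarrow> 'a" where
  "sum_adj_on S d A x = (\<Sum>j=1..d. adjoint_on S (A j) (A j x))"

definition spherically_quasinormal_on ::
  "'a::complex_hilbert set \<Rightarrow> nat \<Rightarrow> (nat \<Rightarrow> 'a \<Rightarrow> 'a) \<Rightarrow> bool" where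
  "spherically_quasinormal_on S d A \<longleftrightarrow> op_tuple_on S d A \<and>
     (\<forall>k\<in>{1..d}. \<forall>x\<in>S. A k (sum_adj_on S d A x) = sum_adj_on S d A (A k x))"

definition normal_op_on :: "'a::complex_hilbert set \<Rightarrow> ('a \<Rightarrow> 'a) \<Rightarrow> bool" where
  "normal_op_on S A \<longleftrightarrow> bounded_op_on S A \<and>
     (\<forall>x\<in>S. adjoint_on S A (A x) = A (adjoint_on S A x))"

definition normal_tuple_on ::
  "'a::complex_hilbert set \<Rightarrow> nat \<Rightarrow> (nat \<Rightarrow> 'a \<Rightarrow> 'a) \<Rightarrow> bool" where
  "normal_tuple_on S d A \<longleftrightarrow>
     (\<forall>k\<in>{1..d}. normal_op_on S (A k)) \<and>
     (\<forall>i\<in>{1..d}. \<forall>j\<in>{1..d}. \<forall>x\<in>S. A i (A j x) = A j (A i x))"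

definition reduces_on :: "'a::complex_hilbert set \<Rightarrow> ('a \<Rightarrow> 'a) \<Rightarrow> 'a set \<Rightarrow> bool" where
  "reduces_on S A M \<longleftrightarrow> closed_csubspace M \<and> M \<subseteq> S \<and>
     A ` M \<subseteq> M \<and> A ` ocompl S M \<subseteq> ocompl S M"

definition pure_on :: "'a::complex_hilbert set \<Rightarrow> nat \<Rightarrow> (nat \<Rightarrow> 'a \<Rightarrow> 'a) \<Rightarrow> bool" where
  "pure_on S d A \<longleftrightarrow>
     \<not> (\<exists>M. closed_csubspace M \<and> M \<subseteq> S \<and> M \<noteq> {0} \<and>
          (\<forall>k\<in>{1..d}. reduces_on S (A k) M) \<and> normal_tuple_on M d A)"

definition normal_extension ::
  "'a::complex_hilbert set \<Rightarrow> 'a set \<Rightarrow> nat \<Rightarrow> (nat \<Rightarrow> 'a \<Rightarrow> 'a) \<Rightarrow> (nat \<Rightarrow> 'a \<Rightarrow> 'a) \<Rightarrow> bool" where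
  "normal_extension H K d T N \<longleftrightarrow> H \<subseteq> K \<and> normal_tuple_on K d N \<and>
     (\<forall>k\<in>{1..d}. N k ` H \<subseteq> H \<and> (\<forall>x\<in>H. N k x = T k x))"

definition minimal_normal_extension ::
  "'a::complex_hilbert set \<Rightarrow> 'a set \<Rightarrow> nat \<Rightarrow> (nat \<Rightarrow> 'a \<Rightarrow> 'a) \<Rightarrow> (nat \<Rightarrow> 'a \<Rightarrow> 'a) \<Rightarrow> bool" where
  "minimal_normal_extension H K d T N \<longleftrightarrow> normal_extension H K d T N \<and>
     \<not> (\<exists>M. closed_csubspace M \<and> H \<subseteq> M \<and> M \<subset> K \<and> (\<forall>k\<in>{1..d}. reduces_on K (N k) M))"

text \<open>
  The column operator of a tuple maps \<open>x\<close> to \<open>(A 1 x, \<dots>, A d x)\<close> in the Hilbert space direct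
  sum of \<open>d\<close> copies of \<open>S\<close>. The norm of this vector is \<open>L2_set (\<lambda>k. norm (A k x)) {1..d}\<close>, and
  the null space of the column operator is the intersection of those of its entries (inside \<open>S\<close>,
  also for \<open>d = 0\<close>).
\<close>

definition column_null_on ::
  "'a::complex_hilbert set \<Rightarrow> nat \<Rightarrow> (nat \<Rightarrow> 'a \<Rightarrow> 'a) \<Rightarrow> 'a set" where
  "column_null_on S d A = S \<inter> (\<Inter>k\<in>{1..d}. null_on S (A k))"

definition column_partial_isometry_on ::
  "'a::complex_hilbert set \<Rightarrow> nat \<Rightarrow> (nat \<Rightarrow> 'a \<Rightarrow> 'a) \<Rightarrow> bool" where
  "column_partial_isometry_on S d U \<longleftrightarrow> op_tuple_on S d U \<and>
     (\<forall>x\<in>ocompl S (column_null_on S d U). L2_set (\<lambda>k. norm (U k x)) {1..d} = norm x)"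

definition spherical_polar_decomposition ::
  "'a::complex_hilbert set \<Rightarrow> nat \<Rightarrow> (nat \<Rightarrow> 'a \<Rightarrow> 'a) \<Rightarrow> (nat \<Rightarrow> 'a \<Rightarrow> 'a) \<Rightarrow> ('a \<Rightarrow> 'a) \<Rightarrow> bool" where
  "spherical_polar_decomposition S d A U Q \<longleftrightarrow>
     sqrt_op_on S (sum_adj_on S d A) Q \<and>
     (\<forall>k\<in>{1..d}. \<forall>x\<in>S. A k x = U k (Q x)) \<and>
     column_partial_isometry_on S d U \<and>
     ocompl S (column_null_on S d U) = ocompl S (null_on S Q) \<and>
     ocompl S (null_on S Q) = ocompl S (column_null_on S d A)"

end

theory Submission
  imports Defs "HOL-Complex_Analysis.Cauchy_Integral_Formula"
begin

text \<open>
  On \<open>H\<close> the operator \<open>P\<^sup>2\<close> is the compression of \<open>R\<^sup>2\<close>. Since \<open>R\<^sup>2\<close> commutes with each \<open>N k\<close>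
  (Fuglede) and \<open>P\<^sup>2\<close> with each \<open>T k\<close>, the vectors \<open>R\<^sup>2 x\<close> and \<open>P\<^sup>2 x\<close> have the same norm for
  \<open>x \<in> H\<close>, so they agree. Uniqueness of positive square roots gives \<open>R = P\<close> on \<open>H\<close>, whence
  \<open>W k\<close> and \<open>V k\<close> agree on the range of \<open>P\<close>; both vanish on its null space.
\<close>

section \<open>Operators on closed subspaces\<close>

text \<open>The compression identity tests \<open>R (R x)\<close> only against vectors of
  \<open>H\<close>, and nothing says in advance that \<open>R\<close>, or even its square, maps
  \<open>H\<close> into itself. For the square, the norm computation overcomes this: moving it past
  each \<open>N j\<close> leaves only values of its quadratic form at vectors of \<open>H\<close>.
  Fuglede's theorem is the price, because \<open>sum_adj_on\<close> involves the adjoints of the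
  \<open>N j\<close>, while the tuple is only known to commute among its own entries. For the root,
  \<open>R\<close> and \<open>P\<close> act on different spaces, so uniqueness is not that of two
  roots of one operator: \<open>D = R - P\<close> on \<open>H\<close> satisfies
  \<open>R D = - D P\<close>, and positivity of both operators forces \<open>R D = 0\<close>. A
  growth comparison of powers shows this without spectral theory.\<close>

instance complex_hilbert \<subseteq> banach ..

section \<open>Algebra of the complex inner product\<close>

lemma cinner_add_right: "cinner x (y + z) = cinner x y + cinner x z"
  by (metis cinner_add_left cinner_commute complex_cnj_add)

lemma cinner_scaleC_right: "cinner x (a *\<^sub>C y) = cnj a * cinner x y"
  by (metis cinner_scaleC_left cinner_commute complex_cnj_mult)

lemma cinner_scaleR_left: "cinner (r *\<^sub>R x) y = r *\<^sub>R cinner x y"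
  by (metis cinner_scaleC_left scaleC_of_real scaleR_conv_of_real)

lemma cinner_scaleR_right: "cinner x (r *\<^sub>R y) = r *\<^sub>R cinner x y"
  by (metis cinner_scaleC_right scaleC_of_real scaleR_conv_of_real complex_cnj_complex_of_real)

lemma cinner_zero_left [simp]: "cinner 0 y = 0"
  using cinner_scaleR_left[of 0 0 y] by simp

lemma cinner_zero_right [simp]: "cinner x 0 = 0"
  using cinner_scaleR_right[of x 0 0] by simp

lemma cinner_minus_left: "cinner (- x) y = - cinner x y"
  using cinner_scaleR_left[of "-1" x y] by simp

lemma cinner_minus_right: "cinner x (- y) = - cinner x y"
  using cinner_scaleR_right[of x "-1" y] by simp

lemma cinner_diff_left: "cinner (x - y) z = cinner x z - cinner y z"
  using cinner_add_left[of x "- y" z] by (simp add: cinner_minus_left)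

lemma cinner_diff_right: "cinner x (y - z) = cinner x y - cinner x z"
  using cinner_add_right[of x y "- z"] by (simp add: cinner_minus_right)

lemma cinner_sum_left: "cinner (\<Sum>i\<in>I. f i) y = (\<Sum>i\<in>I. cinner (f i) y)"
  by (induction I rule: infinite_finite_induct) (auto simp: cinner_add_left)

lemma cinner_self: "cinner x x = complex_of_real ((norm x)\<^sup>2)"
proof (rule complex_eqI)
  show "Re (cinner x x) = Re (complex_of_real ((norm x)\<^sup>2))"
    by (simp add: Re_cinner power2_norm_eq_inner)
  show "Im (cinner x x) = Im (complex_of_real ((norm x)\<^sup>2))"
    using cinner_commute[of x x] by (simp add: complex_eq_iff)
qed

lemma cinner_eq_zero_iff [simp]: "cinner x x = 0 \<longleftrightarrow> x = 0"
  by (simp add: cinner_self)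

lemma norm_scaleC: "norm (a *\<^sub>C x) = cmod a * norm x"
proof -
  have "complex_of_real ((norm (a *\<^sub>C x))\<^sup>2) = complex_of_real ((cmod a * norm x)\<^sup>2)"
    by (simp only: cinner_self[symmetric] cinner_scaleC_left cinner_scaleC_right)
      (simp add: cinner_self power_mult_distrib complex_norm_square del: of_real_power)
  then have "(norm (a *\<^sub>C x))\<^sup>2 = (cmod a * norm x)\<^sup>2"
    using of_real_eq_iff by blast
  then show ?thesis
    by (simp add: power2_eq_iff_nonneg)
qed

lemma scaleC_one [simp]: "1 *\<^sub>C x = (x :: 'a::complex_hilbert)"
  using scaleC_of_real[of 1 x] by simp

lemma scaleC_minus_one: "(- 1) *\<^sub>C x = - (x :: 'a::complex_hilbert)"
  using scaleC_of_real[of "- 1" x] by simp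

lemma scaleC_zero_right [simp]: "a *\<^sub>C 0 = (0 :: 'a::complex_hilbert)"
  by (metis norm_scaleC norm_zero mult_zero_right norm_eq_zero)

lemma scaleC_minus_right: "a *\<^sub>C (- x) = - (a *\<^sub>C (x :: 'a::complex_hilbert))"
  using scaleC_add_right[of a x "- x"] by (simp add: eq_neg_iff_add_eq_0 add.commute)

lemma scaleC_diff_right: "a *\<^sub>C (x - y) = a *\<^sub>C x - a *\<^sub>C (y :: 'a::complex_hilbert)"
  using scaleC_add_right[of a x "- y"] by (simp add: scaleC_minus_right)

text \<open>The real Cauchy-Schwarz inequality controls only the real part; the unimodular
  \<open>u\<close> rotates the inner product onto the nonnegative axis.\<close>

lemma norm_cinner_le: "norm (cinner x y) \<le> norm x * norm y"
proof -
  define c where "c = cinner x y"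
  define u where "u = (if c = 0 then 1 else cnj c / cmod c)"
  have u: "cmod u = 1" "u * c = cmod c"
    using complex_norm_square[of c]
    by (auto simp: u_def norm_divide power2_eq_square field_simps)
  have "cmod c = Re (cinner (u *\<^sub>C x) y)"
    using u(2) by (simp add: cinner_scaleC_left c_def)
  also have "\<dots> \<le> norm (u *\<^sub>C x) * norm y"
    by (simp add: Re_cinner norm_cauchy_schwarz)
  finally show ?thesis
    using u(1) by (simp add: norm_scaleC c_def)
qed

lemma bounded_bilinear_cinner: "bounded_bilinear cinner"
  by standard
    (auto simp: cinner_add_left cinner_add_right cinner_scaleR_left cinner_scaleR_right
      intro!: exI[of _ 1] norm_cinner_le)

section \<open>Closed subspaces and Riesz representation\<close>

lemma cinner_left_eqI:
  assumes "closed_csubspace S" "x \<in> S" "y \<in> S" "\<And>z. z \<in> S \<Longrightarrow> cinner x z = cinner y z"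
  shows "x = y"
proof -
  have "x + (- 1) *\<^sub>C y \<in> S"
    using assms unfolding closed_csubspace_def by blast
  then have "x - y \<in> S"
    by (simp add: scaleC_minus_one)
  then have "cinner (x - y) (x - y) = 0"
    using assms by (simp add: cinner_diff_left)
  then show ?thesis by simp
qed

lemma closed_csubspaceD:
  assumes "closed_csubspace S"
  shows "closed S" "0 \<in> S" "x \<in> S \<Longrightarrow> y \<in> S \<Longrightarrow> x + y \<in> S" "x \<in> S \<Longrightarrow> a *\<^sub>C x \<in> S"
    "x \<in> S \<Longrightarrow> y \<in> S \<Longrightarrow> x - y \<in> S" "x \<in> S \<Longrightarrow> r *\<^sub>R x \<in> S"
proof -
  show *: "closed S" "0 \<in> S" "x \<in> S \<Longrightarrow> y \<in> S \<Longrightarrow> x + y \<in> S" "x \<in> S \<Longrightarrow> a *\<^sub>C x \<in> S" for x y a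
    using assms unfolding closed_csubspace_def by auto
  show "x \<in> S \<Longrightarrow> y \<in> S \<Longrightarrow> x - y \<in> S"
    using *(3)[of x "- y"] *(4)[of y "- 1"] by (simp add: scaleC_minus_one)
  show "x \<in> S \<Longrightarrow> r *\<^sub>R x \<in> S"
    using *(4)[of x "complex_of_real r"] by (simp add: scaleC_of_real)
qed

lemma closed_csubspace_UNIV [simp]: "closed_csubspace UNIV"
  by (simp add: closed_csubspace_def)

text \<open>The representing vector minimises \<open>x \<mapsto> norm x ^ 2 - 2 * f x\<close> over \<open>S\<close>; a minimising
  sequence is Cauchy by the parallelogram law.\<close>

lemma riesz_real:
  fixes f :: "'a::complex_hilbert \<Rightarrow> real"
  assumes S: "closed_csubspace S"
    and add: "\<And>x y. x \<in> S \<Longrightarrow> y \<in> S \<Longrightarrow> f (x + y) = f x + f y"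
    and scale: "\<And>r x. x \<in> S \<Longrightarrow> f (r *\<^sub>R x) = r * f x"
    and bound: "\<And>x. x \<in> S \<Longrightarrow> \<bar>f x\<bar> \<le> C * norm x"
  obtains b where "b \<in> S" "\<And>x. x \<in> S \<Longrightarrow> f x = inner x b"
proof -
  note SD = closed_csubspaceD[OF S]
  have diff: "f (x - y) = f x - f y" if "x \<in> S" "y \<in> S" for x y
    using add[of x "(-1) *\<^sub>R y"] scale[of y "-1"] that SD(6)[of y "-1"] by simp
  define q where "q x = (norm x)\<^sup>2 - 2 * f x" for x
  define m where "m = Inf (q ` S)"
  have lb: "- C\<^sup>2 \<le> q x" if "x \<in> S" for x
  proof -
    have "0 \<le> (norm x - C)\<^sup>2" by simp
    then have "2 * (C * norm x) \<le> (norm x)\<^sup>2 + C\<^sup>2"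
      by (simp add: power2_diff algebra_simps)
    with bound[OF that] show ?thesis by (simp add: q_def abs_le_iff)
  qed
  have bdd: "bdd_below (q ` S)"
    using lb by (auto intro!: bdd_belowI)
  have ne: "q ` S \<noteq> {}" using SD(2) by auto
  have m_le: "m \<le> q x" if "x \<in> S" for x
    unfolding m_def using bdd that by (auto intro: cInf_lower)
  have "\<exists>x\<in>S. q x < m + 1 / real (Suc n)" for n
  proof -
    have "Inf (q ` S) < m + 1 / real (Suc n)"
      by (simp add: m_def)
    then show ?thesis
      using cInf_less_iff[OF ne bdd] by auto
  qed
  then have "\<forall>n. \<exists>x. x \<in> S \<and> q x < m + 1 / real (Suc n)" by blast
  from choice[OF this] obtain X where XS: "\<And>n. X n \<in> S"
    and X: "\<And>n. q (X n) < m + 1 / real (Suc n)"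
    by blast
  have par: "(norm (x - y))\<^sup>2 \<le> 2 * (q x - m) + 2 * (q y - m)" if "x \<in> S" "y \<in> S" for x y
  proof -
    have mid: "(1/2) *\<^sub>R (x + y) \<in> S" using that by (intro SD)
    have "(norm (x - y))\<^sup>2 + (norm (x + y))\<^sup>2 = 2 * (norm x)\<^sup>2 + 2 * (norm y)\<^sup>2"
      by (simp add: power2_norm_eq_inner inner_simps inner_commute)
    moreover have "(norm ((1/2) *\<^sub>R (x + y)))\<^sup>2 = (norm (x + y))\<^sup>2 / 4"
      by (simp add: power_divide)
    moreover have "f ((1/2) *\<^sub>R (x + y)) = (f x + f y) / 2"
      using scale[OF SD(3)[OF that], of "1/2"] add[OF that] by simp
    ultimately show ?thesis
      using m_le[OF mid] by (simp add: q_def)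
  qed
  have "Cauchy X"
  proof (rule metric_CauchyI)
    fix e :: real assume e: "0 < e"
    \<comment> \<open>In \<open>par\<close> each of the two defects carries a factor 2, so defects
      below a quarter of the squared tolerance suffice.\<close>
    obtain M where M: "M > 0" "inverse (real M) < e\<^sup>2 / 4"
      using real_arch_inverse[of "e\<^sup>2 / 4"] e by auto
    have "dist (X i) (X j) < e" if "i \<ge> M" "j \<ge> M" for i j
    proof -
      have lt: "q (X k) - m < e\<^sup>2 / 4" if "k \<ge> M" for k
      proof -
        have "1 / real (Suc k) \<le> inverse (real M)"
          using M that by (simp add: field_simps)
        with X[of k] M show ?thesis by linarith
      qed
      have "(norm (X i - X j))\<^sup>2 < e\<^sup>2"
      proof (rule order.strict_trans1[OF par[OF XS XS]])
        show "2 * (q (X i) - m) + 2 * (q (X j) - m) < e\<^sup>2"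
          using lt[OF that(1)] lt[OF that(2)] by argo
      qed
      then show ?thesis
        using power2_less_imp_less[of "norm (X i - X j)" e] e by (simp add: dist_norm)
    qed
    then show "\<exists>M. \<forall>i\<ge>M. \<forall>j\<ge>M. dist (X i) (X j) < e" by blast
  qed
  then obtain b where Xb: "X \<longlonglongrightarrow> b"
    using Cauchy_convergent convergent_def by blast
  have bS: "b \<in> S"
    using SD(1) XS Xb closed_sequentially by blast
  have fX: "(\<lambda>n. f (X n)) \<longlonglongrightarrow> f b"
  proof (rule Lim_null[THEN iffD2], rule Lim_null_comparison)
    show "\<forall>\<^sub>F n in sequentially. norm (f (X n) - f b) \<le> C * norm (X n - b)"
      using bound[OF SD(5)[OF XS bS]] by (simp add: diff[OF XS bS])
    show "(\<lambda>n. C * norm (X n - b)) \<longlonglongrightarrow> 0"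
      using Xb by (intro tendsto_mult_right_zero tendsto_norm_zero) (simp add: LIM_zero)
  qed
  have "(\<lambda>n. q (X n)) \<longlonglongrightarrow> q b"
    unfolding q_def by (intro tendsto_intros Xb fX)
  moreover have "(\<lambda>n. m + 1 / real (Suc n)) \<longlonglongrightarrow> m + 0"
    by (intro tendsto_intros LIMSEQ_inverse_real_of_nat[unfolded inverse_eq_divide])
  ultimately have "q b \<le> m"
    using X by (intro LIMSEQ_le[of "\<lambda>n. q (X n)" _ "\<lambda>n. m + 1 / real (Suc n)"]) (auto intro: less_imp_le)
  then have min: "q b \<le> q x" if "x \<in> S" for x
    using m_le[OF that] by linarith
  have "f x = inner x b" if x: "x \<in> S" for x
  proof (rule ccontr)
    define g where "g = f x - inner x b"
    assume "f x \<noteq> inner x b"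
    then have g: "g \<noteq> 0" by (simp add: g_def)
    \<comment> \<open>A step from \<open>b\<close> along \<open>x\<close> changes \<open>q\<close>
      by \<open>t\<^sup>2 * (norm x)\<^sup>2 - 2 * t * g\<close>, negative for small
      \<open>t\<close> of the sign of \<open>g\<close>. The summand 1 in the denominator covers
      \<open>x = 0\<close>.\<close>
    define t where "t = g / (1 + (norm x)\<^sup>2)"
    have pos: "1 + (norm x)\<^sup>2 > 0" by (simp add: add_pos_nonneg)
    have "q b \<le> q (b + t *\<^sub>R x)"
      using bS x by (intro min SD)
    also have "\<dots> = q b - 2 * t * g + t\<^sup>2 * (norm x)\<^sup>2"
    proof -
      have "(norm (b + t *\<^sub>R x))\<^sup>2 = (norm b)\<^sup>2 + 2 * t * inner x b + t\<^sup>2 * (norm x)\<^sup>2"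
        unfolding power2_norm_eq_inner
        by (simp add: inner_add_left inner_add_right inner_commute power2_eq_square)
      moreover have "f (b + t *\<^sub>R x) = f b + t * f x"
        using add[OF bS SD(6)[OF x]] scale[OF x] by simp
      ultimately show ?thesis
        by (simp add: q_def g_def algebra_simps)
    qed
    finally have "2 * t * g \<le> t\<^sup>2 * (norm x)\<^sup>2" by linarith
    also have "\<dots> \<le> t\<^sup>2 * (1 + (norm x)\<^sup>2)" by (simp add: algebra_simps)
    also have "\<dots> = t * g"
      using pos by (simp add: t_def power2_eq_square)
    finally have "t * g \<le> 0" by linarith
    moreover have "t * g = g\<^sup>2 / (1 + (norm x)\<^sup>2)"
      unfolding t_def power2_eq_square by (rule times_divide_eq_left)
    moreover have "0 < g\<^sup>2 / (1 + (norm x)\<^sup>2)"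
      using g by (intro divide_pos_pos pos) simp
    ultimately show False by linarith
  qed
  with bS that show ?thesis by blast
qed

text \<open>The real version represents the real part; complex linearity recovers the imaginary part
  from the real part at \<open>\<i> *\<^sub>C x\<close>.\<close>

lemma riesz:
  fixes f :: "'a::complex_hilbert \<Rightarrow> complex"
  assumes S: "closed_csubspace S"
    and add: "\<And>x y. x \<in> S \<Longrightarrow> y \<in> S \<Longrightarrow> f (x + y) = f x + f y"
    and scale: "\<And>a x. x \<in> S \<Longrightarrow> f (a *\<^sub>C x) = a * f x"
    and bound: "\<And>x. x \<in> S \<Longrightarrow> cmod (f x) \<le> C * norm x"
  obtains b where "b \<in> S" "\<And>x. x \<in> S \<Longrightarrow> f x = cinner x b"
proof -
  have sR: "Re (f (r *\<^sub>R x)) = r * Re (f x)" if "x \<in> S" for r x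
    using scale[OF that, of "complex_of_real r"] by (simp add: scaleC_of_real)
  obtain b where b: "b \<in> S" "\<And>x. x \<in> S \<Longrightarrow> Re (f x) = inner x b"
    by (rule riesz_real[of S "\<lambda>x. Re (f x)" C])
      (use S bound in \<open>auto simp: add sR intro: order_trans[OF abs_Re_le_cmod]\<close>)
  have "f x = cinner x b" if x: "x \<in> S" for x
  proof (rule complex_eqI)
    show "Re (f x) = Re (cinner x b)"
      using b x by (simp add: Re_cinner)
    have "\<i> *\<^sub>C x \<in> S" using x closed_csubspaceD[OF S] by blast
    then have "Re (f (\<i> *\<^sub>C x)) = Re (cinner (\<i> *\<^sub>C x) b)"
      using b by (simp add: Re_cinner)
    then show "Im (f x) = Im (cinner x b)"
      using x by (simp add: scale cinner_scaleC_left)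
  qed
  with b that show ?thesis by blast
qed

section \<open>Bounded operators and adjoints on a subspace\<close>

lemma bounded_op_onD:
  assumes "bounded_op_on S A"
  shows "x \<in> S \<Longrightarrow> A x \<in> S"
    "x \<in> S \<Longrightarrow> y \<in> S \<Longrightarrow> A (x + y) = A x + A y"
    "x \<in> S \<Longrightarrow> A (a *\<^sub>C x) = a *\<^sub>C A x"
  using assms unfolding bounded_op_on_def by auto

lemma bounded_op_on_diff:
  assumes "bounded_op_on S A" "closed_csubspace S" "x \<in> S" "y \<in> S"
  shows "A (x - y) = A x - A y"
  using bounded_op_onD(2)[OF assms(1), of x "- y"] bounded_op_onD(3)[OF assms(1), of y "- 1"]
    closed_csubspaceD(4)[OF assms(2), of y "- 1"] assms
  by (simp add: scaleC_minus_one)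

lemma bounded_op_on_zero:
  assumes "bounded_op_on S A" "closed_csubspace S"
  shows "A 0 = 0"
  using bounded_op_on_diff[OF assms, of 0 0] closed_csubspaceD(2)[OF assms(2)] by simp

lemma bounded_op_on_bound:
  assumes "bounded_op_on S A"
  obtains C where "C > 0" "\<And>x. x \<in> S \<Longrightarrow> norm (A x) \<le> C * norm x"
proof -
  obtain C where C: "\<And>x. x \<in> S \<Longrightarrow> norm (A x) \<le> C * norm x"
    using assms unfolding bounded_op_on_def by blast
  have "norm (A x) \<le> (\<bar>C\<bar> + 1) * norm x" if "x \<in> S" for x
    by (rule order_trans[OF C[OF that]]) (auto intro: mult_right_mono)
  then show ?thesis using that[of "\<bar>C\<bar> + 1"] by auto
qed

lemma bounded_op_on_continuous:
  assumes "bounded_op_on S A" "closed_csubspace S"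
  shows "continuous_on S A"
proof -
  obtain C where C: "C > 0" "\<And>x. x \<in> S \<Longrightarrow> norm (A x) \<le> C * norm x"
    by (rule bounded_op_on_bound[OF assms(1)]) blast
  have "C-lipschitz_on S A"
  proof (rule lipschitz_onI)
    fix x y assume "x \<in> S" "y \<in> S"
    then show "dist (A x) (A y) \<le> C * dist x y"
      using C(2)[of "x - y"] closed_csubspaceD(5)[OF assms(2)]
      by (simp add: dist_norm bounded_op_on_diff[OF assms])
  qed (use C in simp)
  then show ?thesis by (rule lipschitz_on_continuous_on)
qed

text \<open>Riesz on \<open>S\<close> supplies a witness for the \<open>SOME\<close> in
  \<open>adjoint_on\<close>. The functional is bounded on \<open>S\<close> for every ambient
  \<open>y\<close>, so the choice function can be taken total.\<close>

lemma adjoint_on_works: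
  assumes S: "closed_csubspace S" and A: "bounded_op_on S A"
  shows adjoint_on_mem: "y \<in> S \<Longrightarrow> adjoint_on S A y \<in> S"
    and cinner_adjoint_on: "x \<in> S \<Longrightarrow> y \<in> S \<Longrightarrow> cinner (A x) y = cinner x (adjoint_on S A y)"
proof -
  have "\<exists>b\<in>S. \<forall>x\<in>S. cinner (A x) y = cinner x b" for y
  proof -
    obtain C where C: "C > 0" "\<And>x. x \<in> S \<Longrightarrow> norm (A x) \<le> C * norm x"
      by (rule bounded_op_on_bound[OF A]) blast
    have "cmod (cinner (A x) y) \<le> (C * norm y) * norm x" if "x \<in> S" for x
      using order_trans[OF norm_cinner_le mult_right_mono[OF C(2)[OF that] norm_ge_zero[of y]]]
      by (simp add: mult_ac)
    note bound = this
    obtain b where "b \<in> S" "\<And>x. x \<in> S \<Longrightarrow> cinner (A x) y = cinner x b"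
      by (rule riesz[of S "\<lambda>x. cinner (A x) y" "C * norm y"])
        (use S bound in \<open>auto simp: bounded_op_onD[OF A] cinner_add_left cinner_scaleC_left\<close>)
    then show ?thesis by blast
  qed
  then have "\<forall>y. \<exists>b. b \<in> S \<and> (\<forall>x\<in>S. cinner (A x) y = cinner x b)" by blast
  from choice[OF this] have "\<exists>B. (\<forall>y\<in>S. B y \<in> S) \<and> (\<forall>x\<in>S. \<forall>y\<in>S. cinner (A x) y = cinner x (B y))"
    by blast
  then have "(\<forall>y\<in>S. adjoint_on S A y \<in> S) \<and>
      (\<forall>x\<in>S. \<forall>y\<in>S. cinner (A x) y = cinner x (adjoint_on S A y))"
    unfolding adjoint_on_def by (rule someI_ex)
  then show "y \<in> S \<Longrightarrow> adjoint_on S A y \<in> S"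
    "x \<in> S \<Longrightarrow> y \<in> S \<Longrightarrow> cinner (A x) y = cinner x (adjoint_on S A y)"
    by auto
qed

lemma cinner_adjoint_on_left:
  assumes "closed_csubspace S" "bounded_op_on S A" "x \<in> S" "y \<in> S"
  shows "cinner (adjoint_on S A x) y = cinner x (A y)"
  using cinner_adjoint_on[OF assms(1,2,4,3)] by (metis cinner_commute)

lemma bounded_op_on_adjoint_on:
  assumes S: "closed_csubspace S" and A: "bounded_op_on S A"
  shows "bounded_op_on S (adjoint_on S A)"
proof -
  note SD = closed_csubspaceD[OF S]
  note mem = adjoint_on_mem[OF S A] and adj = cinner_adjoint_on_left[OF S A]
  have "adjoint_on S A (x + y) = adjoint_on S A x + adjoint_on S A y" if "x \<in> S" "y \<in> S" for x y
    using that by (intro cinner_left_eqI[OF S]) (auto simp: mem SD adj cinner_add_left)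
  moreover have "adjoint_on S A (a *\<^sub>C x) = a *\<^sub>C adjoint_on S A x" if "x \<in> S" for a x
    using that by (intro cinner_left_eqI[OF S]) (auto simp: mem SD adj cinner_scaleC_left)
  moreover obtain C where C: "C > 0" "\<And>x. x \<in> S \<Longrightarrow> norm (A x) \<le> C * norm x"
    by (rule bounded_op_on_bound[OF A]) blast
  moreover have "norm (adjoint_on S A x) \<le> C * norm x" if x: "x \<in> S" for x
  proof -
    let ?y = "adjoint_on S A x"
    have y: "?y \<in> S" using x mem by blast
    have "(norm ?y)\<^sup>2 = cmod (cinner x (A ?y))"
      by (simp only: adj[OF x y, symmetric] cinner_self norm_of_real abs_power2)
    also have "\<dots> \<le> norm x * (C * norm ?y)"
      by (rule order_trans[OF norm_cinner_le mult_left_mono[OF C(2)[OF y]]]) simp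
    finally have "norm ?y * norm ?y \<le> (C * norm x) * norm ?y"
      by (simp add: power2_eq_square mult_ac)
    then show ?thesis
      using C(1) by (cases "?y = 0") auto
  qed
  ultimately show ?thesis
    unfolding bounded_op_on_def using mem by blast
qed

section \<open>Fuglede's theorem\<close>

text \<open>Absolute summability of the double family allows summation by rows or by antidiagonals.
  Real bilinearity is the right generality: \<open>prod\<close> will be
  \<open>cinner (A x) y\<close>, which is conjugate linear in \<open>y\<close>.\<close>

lemma bounded_bilinear_Cauchy_product_sums:
  fixes a :: "nat \<Rightarrow> 'a::banach" and b :: "nat \<Rightarrow> 'b::banach"
    and prod :: "'a \<Rightarrow> 'b \<Rightarrow> 'c::banach"
  assumes bil: "bounded_bilinear prod"
    and a: "summable (\<lambda>n. norm (a n))" and b: "summable (\<lambda>n. norm (b n))"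
  shows "(\<lambda>n. \<Sum>i\<le>n. prod (a i) (b (n - i))) sums prod (suminf a) (suminf b)"
proof -
  interpret bounded_bilinear prod by (rule bil)
  obtain K where K: "\<And>x y. norm (prod x y) \<le> norm x * norm y * K"
    using bounded by blast
  have suma: "(a has_sum suminf a) UNIV" and sumb: "(b has_sum suminf b) UNIV"
    using a b by (auto intro!: norm_summable_imp_has_sum summable_sums summable_norm_cancel)
  have na: "((\<lambda>n. norm (a n)) has_sum (\<Sum>n. norm (a n))) UNIV"
    and nb: "((\<lambda>n. norm (b n)) has_sum (\<Sum>n. norm (b n))) UNIV"
    using a b by (auto intro!: norm_summable_imp_has_sum summable_sums)
  let ?f = "\<lambda>(i, j). prod (a i) (b j)"
  have "(\<lambda>(i, j). norm (a i) * K * norm (b j)) summable_on (UNIV \<times> UNIV)"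
  proof (rule summable_on_SigmaI[where g = "\<lambda>i. norm (a i) * K * (\<Sum>n. norm (b n))"])
    show "((\<lambda>j. case (i, j) of (i, j) \<Rightarrow> norm (a i) * K * norm (b j)) has_sum
        norm (a i) * K * (\<Sum>n. norm (b n))) UNIV" for i
      using has_sum_cmult_right[OF nb, of "norm (a i) * K"] by simp
    have "(\<lambda>i. norm (a i)) summable_on UNIV"
      using na by (rule has_sum_imp_summable)
    then show "(\<lambda>i. norm (a i) * K * (\<Sum>n. norm (b n))) summable_on UNIV"
      by (intro summable_on_cmult_left)
    \<comment> \<open>The sign of \<open>K\<close> is unknown; the product is nonnegative because it
      bounds a norm.\<close>
    show "0 \<le> (case (i, j) of (i, j) \<Rightarrow> norm (a i) * K * norm (b j))" for i j
      using order_trans[OF norm_ge_zero K[of "a i" "b j"]] by (simp add: mult_ac)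
  qed
  then have "(\<lambda>p. norm (?f p)) summable_on (UNIV \<times> UNIV)"
    by (rule Infinite_Sum.abs_summable_on_comparison_test') (use K in \<open>auto simp: mult_ac\<close>)
  then have "?f summable_on (UNIV \<times> UNIV)"
    by (rule abs_summable_summable)
  then have "(?f has_sum prod (suminf a) (suminf b)) (UNIV \<times> UNIV)"
    by (rule has_sum_SigmaI[where g = "\<lambda>i. prod (a i) (suminf b)", rotated 2])
      (auto intro: has_sum_bounded_linear[OF bounded_linear_right sumb]
        has_sum_bounded_linear[OF bounded_linear_left suma])
  moreover have "(?f has_sum s) (UNIV \<times> UNIV) \<longleftrightarrow>
      ((\<lambda>(n, i). prod (a i) (b (n - i))) has_sum s) (SIGMA n:UNIV. {..n})" for s
    by (rule has_sum_reindex_bij_witness[of _ "\<lambda>(n, i). (i, n - i)" "\<lambda>(i, j). (i + j, i)"]) auto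
  ultimately have "((\<lambda>(n, i). prod (a i) (b (n - i))) has_sum prod (suminf a) (suminf b))
      (SIGMA n:UNIV. {..n})"
    by blast
  then have "((\<lambda>n. \<Sum>i\<le>n. prod (a i) (b (n - i))) has_sum prod (suminf a) (suminf b)) UNIV"
    by (rule has_sum_SigmaD) (auto intro: has_sum_finiteI)
  then show ?thesis by (rule has_sum_imp_sums)
qed

text \<open>By Liouville the sum is constant, and \<open>c 1\<close> is its derivative at 0. In
  \<open>fuglede\<close> this coefficient is the inner product of \<open>A (M x) - M (A x)\<close>
  with a test vector.\<close>

lemma bounded_entire_power_series_linear_coeff:
  fixes c :: "nat \<Rightarrow> complex"
  assumes summable: "\<And>z. summable (\<lambda>n. c n * z ^ n)"
    and bound: "\<And>z. cmod (\<Sum>n. c n * z ^ n) \<le> B"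
  shows "c 1 = 0"
proof -
  define f where "f z = (\<Sum>n. c n * z ^ n)" for z
  have deriv: "(f has_field_derivative (\<Sum>n. diffs c n * z ^ n)) (at z)" for z
    unfolding f_def by (rule termdiffs_strong_converges_everywhere[OF summable])
  then have "f holomorphic_on UNIV"
    by (auto simp: holomorphic_on_def field_differentiable_def intro: has_field_derivative_at_within)
  moreover have "bounded (range f)"
    using bound by (auto simp: f_def bounded_iff)
  ultimately have "f constant_on UNIV" by (rule Liouville_theorem)
  then obtain k where "f = (\<lambda>_. k)" unfolding constant_on_def by blast
  then have "(f has_field_derivative 0) (at 0)" by simp
  with deriv[of 0] have "(\<Sum>n. diffs c n * 0 ^ n) = 0" by (rule DERIV_unique)
  then show ?thesis by (simp add: diffs_def)
qed

text \<open>Pascal's rule in the form needed for a Leibniz induction: the arguments of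
  \<open>h\<close> are the two exponents, and one more derivation raises either of them.\<close>

lemma sum_binomial_Suc:
  fixes h :: "nat \<Rightarrow> nat \<Rightarrow> 'a::comm_semiring_1"
  shows "(\<Sum>i\<le>Suc n. of_nat (Suc n choose i) * h i (Suc n - i)) =
    (\<Sum>i\<le>n. of_nat (n choose i) * (h (Suc i) (n - i) + h i (Suc (n - i))))"
proof -
  have "(\<Sum>i\<le>Suc n. of_nat (Suc n choose i) * h i (Suc n - i)) =
    h 0 (Suc n) + (\<Sum>i\<le>n. of_nat ((n choose Suc i) + (n choose i)) * h (Suc i) (n - i))"
    by (subst sum.atMost_Suc_shift) (simp add: add.commute)
  also have "\<dots> = (\<Sum>i\<le>n. of_nat (n choose i) * h (Suc i) (n - i)) +
      (h 0 (Suc n) + (\<Sum>i\<le>n. of_nat (n choose Suc i) * h (Suc i) (n - i)))"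
    by (simp add: algebra_simps sum.distrib)
  also have "h 0 (Suc n) + (\<Sum>i\<le>n. of_nat (n choose Suc i) * h (Suc i) (n - i)) =
      (\<Sum>i\<le>Suc n. of_nat (n choose i) * h i (Suc n - i))"
    by (subst sum.atMost_Suc_shift) simp
  \<comment> \<open>The top term drops out because \<open>n choose Suc n\<close> is 0.\<close>
  also have "\<dots> = (\<Sum>i\<le>n. of_nat (n choose i) * h i (Suc (n - i)))"
    by (simp add: Suc_diff_le binomial_eq_0)
  finally show ?thesis by (simp add: algebra_simps sum.distrib)
qed

text \<open>The order \<open>A S - S A\<close> makes the iterates the Taylor coefficients of
  \<open>exp(-S) A exp(S)\<close> with no alternating signs.\<close>

definition commutator :: "('a \<Rightarrow> 'a) \<Rightarrow> ('a \<Rightarrow> 'a) \<Rightarrow> 'a \<Rightarrow> 'a::ab_group_add" where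
  "commutator S A x = A (S x) - S (A x)"

text \<open>Leibniz expands the iterate into terms \<open>(-S)^(n-i) A S^i\<close>; skewness moves
  the left factor to \<open>y\<close> and absorbs its sign.\<close>

lemma cinner_commutator_funpow:
  assumes skew: "\<And>x y. cinner (S x) y = - cinner x (S y)"
  shows "cinner ((commutator S ^^ n) A x) y =
    (\<Sum>i\<le>n. of_nat (n choose i) * cinner (A ((S ^^ i) x)) ((S ^^ (n - i)) y))"
proof (induction n arbitrary: x y)
  case (Suc n)
  let ?B = "(commutator S ^^ n) A"
  have "cinner ((commutator S ^^ Suc n) A x) y = cinner (?B (S x)) y + cinner (?B x) (S y)"
    by (simp add: commutator_def cinner_diff_left skew)
  also have "\<dots> = (\<Sum>i\<le>n. of_nat (n choose i) *
      (cinner (A ((S ^^ Suc i) x)) ((S ^^ (n - i)) y) +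
       cinner (A ((S ^^ i) x)) ((S ^^ Suc (n - i)) y)))"
    by (simp only: Suc.IH) (simp add: funpow_swap1 algebra_simps sum.distrib)
  also have "\<dots> = (\<Sum>i\<le>Suc n. of_nat (Suc n choose i) *
      cinner (A ((S ^^ i) x)) ((S ^^ (Suc n - i)) y))"
    by (rule sum_binomial_Suc[symmetric])
  finally show ?case .
qed simp

text \<open>Summed pointwise, since operators here are bare functions without a norm.\<close>

definition exp_op :: "('a \<Rightarrow> 'a) \<Rightarrow> 'a \<Rightarrow> 'a::real_normed_vector" where
  "exp_op S x = (\<Sum>n. (1 / fact n) *\<^sub>R (S ^^ n) x)"

lemma summable_exp_op:
  fixes S :: "'a \<Rightarrow> 'a::real_normed_vector"
  assumes "bounded_linear S"
  shows "summable (\<lambda>n. norm ((1 / fact n) *\<^sub>R (S ^^ n) x))"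
proof -
  obtain L where L: "L > 0" "\<And>x. norm (S x) \<le> norm x * L"
    using bounded_linear.pos_bounded[OF assms] by blast
  have "norm ((S ^^ n) x) \<le> L ^ n * norm x" for n
  proof (induction n)
    case (Suc n)
    have "norm ((S ^^ Suc n) x) \<le> norm ((S ^^ n) x) * L"
      using L(2) by simp
    also have "\<dots> \<le> (L ^ n * norm x) * L"
      using Suc L(1) by (intro mult_right_mono) auto
    finally show ?case by (simp add: mult_ac)
  qed simp
  then have "norm (norm ((1 / fact n) *\<^sub>R (S ^^ n) x)) \<le> inverse (fact n) * L ^ n * norm x" for n
    by (simp add: divide_inverse mult_ac mult_left_mono)
  moreover have "summable (\<lambda>n. inverse (fact n) * L ^ n * norm x)"
    using summable_exp[of L] by (rule summable_mult2)
  ultimately show ?thesis by (rule summable_comparison_test'[rotated])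
qed

text \<open>For skew \<open>S\<close> the adjoint of \<open>exp S\<close> is \<open>exp(-S)\<close>,
  so the limit is the form of \<open>exp(-S) A exp(S)\<close>. On the series side, the antidiagonals
  of the Cauchy product are the binomial sums divided by \<open>fact n\<close>.\<close>

lemma commutator_exp_sums:
  fixes A S :: "'a::complex_hilbert \<Rightarrow> 'a"
  assumes S: "bounded_linear S" and A: "bounded_linear A"
    and skew: "\<And>x y. cinner (S x) y = - cinner x (S y)"
  shows "(\<lambda>n. cinner ((commutator S ^^ n) A x) y / fact n) sums
    cinner (A (exp_op S x)) (exp_op S y)"
proof -
  let ?e = "\<lambda>x n. (1 / fact n) *\<^sub>R (S ^^ n) x"
  note e = summable_exp_op[OF S]
  have bil: "bounded_bilinear (\<lambda>x y. cinner (A x) y)"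
    using bounded_bilinear.comp1[OF bounded_bilinear_cinner A] .
  have "(\<lambda>n. \<Sum>i\<le>n. cinner (A (?e x i)) (?e y (n - i))) sums
      cinner (A (exp_op S x)) (exp_op S y)"
    using bounded_bilinear_Cauchy_product_sums[OF bil e e] by (simp add: exp_op_def)
  moreover have "(\<Sum>i\<le>n. cinner (A (?e x i)) (?e y (n - i))) =
      cinner ((commutator S ^^ n) A x) y / fact n" for n
  proof -
    have "cinner (A (?e x i)) (?e y (n - i)) =
        of_nat (n choose i) * cinner (A ((S ^^ i) x)) ((S ^^ (n - i)) y) / fact n" if "i \<le> n" for i
    proof -
      have "(of_nat (n choose i) :: complex) = fact n / (fact i * fact (n - i))"
        by (rule binomial_fact[OF that])
      then show ?thesis
        by (simp add: linear_simps[OF A] cinner_scaleR_left cinner_scaleR_right scaleR_conv_of_real)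
    qed
    then show ?thesis
      by (simp add: cinner_commutator_funpow[OF skew] sum_divide_distrib)
  qed
  ultimately show ?thesis by simp
qed

text \<open>Taking \<open>A\<close> to be the identity in the commutator series leaves only its zeroth term.\<close>

lemma norm_exp_op:
  fixes S :: "'a::complex_hilbert \<Rightarrow> 'a"
  assumes S: "bounded_linear S"
    and skew: "\<And>x y. cinner (S x) y = - cinner x (S y)"
  shows "norm (exp_op S x) = norm x"
proof -
  have zero: "(commutator S ^^ Suc n) (\<lambda>x. x) = (\<lambda>_. 0)" for n
    by (induction n) (auto simp: commutator_def linear_simps[OF S])
  have "(\<lambda>n. cinner ((commutator S ^^ n) (\<lambda>x. x) x) x / fact n) sums
      cinner (exp_op S x) (exp_op S x)"
    by (rule commutator_exp_sums[OF S bounded_linear_ident skew])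
  moreover have "(\<lambda>n. cinner ((commutator S ^^ n) (\<lambda>x. x) x) x / fact n) sums
      (\<Sum>n\<in>{0}. cinner ((commutator S ^^ n) (\<lambda>x. x) x) x / fact n)"
  proof (rule sums_finite)
    fix n :: nat assume "n \<notin> {0}"
    then obtain m where "n = Suc m" by (auto simp: gr0_conv_Suc)
    then show "cinner ((commutator S ^^ n) (\<lambda>x. x) x) x / fact n = 0"
      by (simp only: zero) simp
  qed simp
  ultimately have "cinner (exp_op S x) (exp_op S x) = cinner x x"
    by (auto dest: sums_unique2)
  then have "(norm (exp_op S x))\<^sup>2 = (norm x)\<^sup>2"
    unfolding cinner_self of_real_eq_iff .
  then show ?thesis by (simp add: power2_eq_iff_nonneg)
qed

lemma bounded_op_on_UNIV_bounded_linear: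
  assumes "bounded_op_on UNIV A"
  shows "bounded_linear A"
proof -
  obtain C where C: "\<And>x. norm (A x) \<le> C * norm x"
    using bounded_op_on_bound[OF assms] by auto
  show ?thesis
  proof (rule bounded_linear_intro)
    show "A (x + y) = A x + A y" for x y
      using bounded_op_onD(2)[OF assms] by simp
    show "A (r *\<^sub>R x) = r *\<^sub>R A x" for r x
      using bounded_op_onD(3)[OF assms, of x "complex_of_real r"] by (simp add: scaleC_of_real)
    show "norm (A x) \<le> norm x * C" for x
      using C by (simp add: mult.commute)
  qed
qed

text \<open>Rosenblum's argument: with the skew-adjoint \<open>S = z M - cnj z N\<close>, commutation of \<open>A\<close>
  with \<open>N\<close> makes the \<open>n\<close>-th iterated commutator of \<open>A\<close> with \<open>S\<close> equal to \<open>z ^ n\<close> times that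
  with \<open>M\<close>, so the entire function with these coefficients is bounded because \<open>exp S\<close> is
  isometric.\<close>

lemma fuglede:
  fixes N M A :: "'a::complex_hilbert \<Rightarrow> 'a"
  assumes N: "bounded_op_on UNIV N" and M: "bounded_op_on UNIV M" and A: "bounded_op_on UNIV A"
    and adj: "\<And>x y. cinner (N x) y = cinner x (M y)"
    and normal: "\<And>x. N (M x) = M (N x)"
    and comm: "\<And>x. A (N x) = N (A x)"
  shows "A (M x) = M (A x)"
proof -
  have adj': "cinner (M x) y = cinner x (N y)" for x y
    using adj by (metis cinner_commute)
  note lin = bounded_op_onD(2,3)[OF N, simplified] bounded_op_onD(2,3)[OF M, simplified]
    bounded_op_on_diff[OF N, simplified] bounded_op_on_diff[OF M, simplified]
  note blin = bounded_op_on_UNIV_bounded_linear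
  define D where "D n = (commutator M ^^ n) A" for n
  have D_Suc: "D (Suc n) x = D n (M x) - M (D n x)" for n x
    by (simp add: D_def commutator_def)
  \<comment> \<open>Normality enters here: \<open>M\<close> commutes with \<open>N\<close>, so
    taking the commutator with \<open>M\<close> preserves commutation with \<open>N\<close>.\<close>
  have D_lin: "(\<forall>x y. D n (x - y) = D n x - D n y) \<and> (\<forall>a x. D n (a *\<^sub>C x) = a *\<^sub>C D n x) \<and>
      (\<forall>x. D n (N x) = N (D n x))" for n
  proof (induction n)
    case 0
    show ?case
      using bounded_op_on_diff[OF A] bounded_op_onD(3)[OF A] comm by (simp add: D_def)
  next
    case (Suc n)
    then show ?case
      by (auto simp: D_Suc lin scaleC_diff_right) (metis normal)+
  qed
  \<comment> \<open>The \<open>cnj z\<close> term is not holomorphic in \<open>z\<close>; it secures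
    skewness and then cancels from every commutator, leaving a power series in
    \<open>z\<close>.\<close>
  define S where "S z x = z *\<^sub>C M x - cnj z *\<^sub>C N x" for z x
  have skew: "cinner (S z x) y = - cinner x (S z y)" for z x y
    by (simp add: S_def cinner_diff_left cinner_diff_right cinner_scaleC_left cinner_scaleC_right
        adj adj')
  have S_lin: "bounded_linear (S z)" for z
  proof -
    have scaleC: "bounded_linear (\<lambda>x :: 'a. a *\<^sub>C x)" for a
    proof (rule bounded_linear_intro)
      show "a *\<^sub>C (r *\<^sub>R x) = r *\<^sub>R (a *\<^sub>C x)" for r and x :: 'a
        by (simp add: scaleC_of_real[symmetric] scaleC_scaleC mult.commute)
      show "norm (a *\<^sub>C x) \<le> norm x * cmod a" for x :: 'a
        by (simp add: norm_scaleC)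
    qed (rule scaleC_add_right)
    show ?thesis
      unfolding S_def
      by (intro bounded_linear_sub bounded_linear_compose[OF scaleC] blin N M)
  qed
  have S_pow: "(commutator (S z) ^^ n) A x = z ^ n *\<^sub>C D n x" for z n x
  proof (induction n arbitrary: x)
    case 0
    show ?case by (simp add: D_def)
  next
    case (Suc n)
    have "(commutator (S z) ^^ Suc n) A x = z ^ n *\<^sub>C D n (S z x) - S z (z ^ n *\<^sub>C D n x)"
      by (simp add: commutator_def Suc)
    also have "\<dots> = z ^ Suc n *\<^sub>C D (Suc n) x"
      using D_lin[of n]
      by (simp add: S_def D_Suc lin scaleC_diff_right scaleC_scaleC mult_ac)
    finally show ?case .
  qed
  obtain K where K: "K > 0" "\<And>x. norm (A x) \<le> K * norm x"
    by (rule bounded_op_on_bound[OF A]) auto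
  have "cinner (A (M x) - M (A x)) y = 0" for y
  proof -
    define c where "c n = cinner (D n x) y / fact n" for n
    have sums: "(\<lambda>n. c n * z ^ n) sums cinner (A (exp_op (S z) x)) (exp_op (S z) y)" for z
      using commutator_exp_sums[OF S_lin blin[OF A] skew, of z x y]
      by (simp add: S_pow c_def cinner_scaleC_left mult_ac)
    have "cmod (cinner (A (exp_op (S z) x)) (exp_op (S z) y)) \<le> K * norm x * norm y" for z
    proof -
      have "norm (A (exp_op (S z) x)) \<le> K * norm x"
        using K(2)[of "exp_op (S z) x"] by (simp add: norm_exp_op[OF S_lin skew])
      then show ?thesis
        using norm_cinner_le[of "A (exp_op (S z) x)" "exp_op (S z) y"]
        by (simp add: norm_exp_op[OF S_lin skew]) (meson mult_right_mono norm_ge_zero order_trans)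
    qed
    then have "c 1 = 0"
      using sums by (intro bounded_entire_power_series_linear_coeff[of c "K * norm x * norm y"])
        (auto simp: sums_iff)
    then show ?thesis
      by (simp add: c_def D_def commutator_def)
  qed
  then have "A (M x) - M (A x) = 0"
    using cinner_eq_zero_iff by blast
  then show ?thesis by simp
qed

section \<open>Positive square roots and polar decompositions\<close>

lemma positive_op_onD:
  assumes "positive_op_on S Q"
  shows "bounded_op_on S Q" "x \<in> S \<Longrightarrow> 0 \<le> Re (cinner (Q x) x)"
  using assms by (auto simp: positive_op_on_def complex_nonneg_Reals_iff)

text \<open>Polarization: the sesquilinear defect \<open>g\<close> vanishes on the diagonal because
  positive values are real, and the pairs \<open>x, y\<close> and \<open>\<i> *\<^sub>C x, y\<close>
  then give both its symmetric and antisymmetric parts.\<close>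

lemma positive_op_on_symmetric:
  assumes S: "closed_csubspace S" and Q: "positive_op_on S Q" and x: "x \<in> S" and y: "y \<in> S"
  shows "cinner (Q x) y = cinner x (Q y)"
proof -
  note SD = closed_csubspaceD[OF S]
  note lin = bounded_op_onD[OF positive_op_onD(1)[OF Q]]
  define g where "g u v = cinner (Q u) v - cinner u (Q v)" for u v
  have diag: "g u u = 0" if "u \<in> S" for u
  proof -
    have "cinner (Q u) u \<in> \<real>"
      using Q that nonneg_Reals_subset_Reals by (auto simp: positive_op_on_def)
    then have "cnj (cinner (Q u) u) = cinner (Q u) u"
      by (simp add: Reals_cnj_iff)
    then show ?thesis
      using cinner_commute[of u "Q u"] by (simp add: g_def)
  qed
  have "g u v + g v u = 0" if "u \<in> S" "v \<in> S" for u v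
    using diag[OF SD(3)[OF that]] diag[OF that(1)] diag[OF that(2)]
    by (simp add: g_def lin(2) that cinner_add_left cinner_add_right algebra_simps)
  from this[OF x y] this[OF SD(4)[OF x, of \<i>] y]
  have "g x y + g y x = 0" "\<i> * (g x y - g y x) = 0"
    by (simp_all add: g_def lin(3) x cinner_scaleC_left cinner_scaleC_right algebra_simps)
  then have "g x y = 0" by simp
  then show ?thesis by (simp add: g_def)
qed

text \<open>This is the operator inequality \<open>Q Q \<le> C Q\<close>, obtained without a root of
  \<open>Q\<close> by testing positivity at \<open>C *\<^sub>R x - Q x\<close>. It makes
  \<open>1 - P / c\<close> a contraction below.\<close>

lemma positive_op_on_norm_square_le:
  assumes S: "closed_csubspace S" and Q: "positive_op_on S Q"
    and C: "C > 0" "\<And>x. x \<in> S \<Longrightarrow> norm (Q x) \<le> C * norm x" and x: "x \<in> S"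
  shows "(norm (Q x))\<^sup>2 \<le> C * inner (Q x) x"
proof -
  note SD = closed_csubspaceD[OF S]
  note lin = bounded_op_onD[OF positive_op_onD(1)[OF Q]]
  have Qx: "Q x \<in> S" using x by (rule lin(1))
  have scale: "Q (C *\<^sub>R x) = C *\<^sub>R Q x"
    using lin(3)[OF x, of "complex_of_real C"] by (simp add: scaleC_of_real)
  have sym: "inner (Q (Q x)) x = (norm (Q x))\<^sup>2"
    using positive_op_on_symmetric[OF S Q Qx x] by (simp add: cinner_self flip: Re_cinner)
  have "0 \<le> Re (cinner (Q (C *\<^sub>R x - Q x)) (C *\<^sub>R x - Q x))"
    using positive_op_onD(2)[OF Q SD(5)[OF SD(6)[OF x] Qx]] .
  also have "\<dots> = C\<^sup>2 * inner (Q x) x - 2 * C * (norm (Q x))\<^sup>2 + inner (Q (Q x)) (Q x)"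
    unfolding bounded_op_on_diff[OF positive_op_onD(1)[OF Q] S SD(6)[OF x] Qx] scale Re_cinner
    by (simp add: inner_diff_left inner_diff_right sym dot_square_norm power2_eq_square
        algebra_simps)
  also have "inner (Q (Q x)) (Q x) \<le> C * (norm (Q x))\<^sup>2"
    using order_trans[OF norm_cauchy_schwarz mult_right_mono[OF C(2)[OF Qx] norm_ge_zero]]
    by (simp add: power2_eq_square mult.assoc)
  finally have "C * (norm (Q x))\<^sup>2 \<le> C * (C * inner (Q x) x)"
    by (simp add: power2_eq_square)
  then show ?thesis using C(1) by simp
qed

text \<open>With \<open>c\<close> a bound for \<open>P\<close>, the powers of \<open>1 + R / c\<close> at \<open>D x\<close> equal \<open>D\<close> applied to
  powers of the contraction \<open>1 - P / c\<close>, hence stay bounded, whereas the square of their norm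
  grows at least linearly unless \<open>R (D x) = 0\<close>.\<close>

lemma positive_sylvester:
  fixes D R P :: "'a::complex_hilbert \<Rightarrow> 'a"
  assumes H: "closed_csubspace H" and P: "positive_op_on H P" and R: "positive_op_on UNIV R"
    and D_diff: "\<And>x y. x \<in> H \<Longrightarrow> y \<in> H \<Longrightarrow> D (x - y) = D x - D y"
    and D_scale: "\<And>r x. x \<in> H \<Longrightarrow> D (r *\<^sub>R x) = r *\<^sub>R D x"
    and D_bound: "\<And>x. x \<in> H \<Longrightarrow> norm (D x) \<le> B * norm x"
    and RD: "\<And>x. x \<in> H \<Longrightarrow> R (D x) = - D (P x)"
    and x: "x \<in> H"
  shows "R (D x) = 0"
proof -
  note HD = closed_csubspaceD[OF H]
  obtain c where c: "c > 0" "\<And>x. x \<in> H \<Longrightarrow> norm (P x) \<le> c * norm x"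
    by (rule bounded_op_on_bound[OF positive_op_onD(1)[OF P]]) blast
  note PH = bounded_op_onD(1)[OF positive_op_onD(1)[OF P]]
  define E where "E x = x - (1 / c) *\<^sub>R P x" for x
  define Q where "Q y = (1 / c) *\<^sub>R R y" for y
  define F where "F y = y + Q y" for y
  have Q_F: "Q (F y) = F (Q y)" for y
    unfolding F_def Q_def
    by (simp add: linear_simps[OF bounded_op_on_UNIV_bounded_linear[OF positive_op_onD(1)[OF R]]]
        scaleR_add_right)
  have F_norm: "(norm y)\<^sup>2 + (norm (Q y))\<^sup>2 \<le> (norm (F y))\<^sup>2" for y
  proof -
    have "(norm (F y))\<^sup>2 = (norm y)\<^sup>2 + (norm (Q y))\<^sup>2 + 2 * inner (Q y) y"
      unfolding F_def power2_norm_eq_inner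
      by (simp add: inner_add_left inner_add_right inner_commute)
    moreover have "0 \<le> inner (Q y) y"
      using positive_op_onD(2)[OF R, of y] c(1) by (simp add: Q_def Re_cinner)
    ultimately show ?thesis by simp
  qed
  have F_ge: "(norm y)\<^sup>2 \<le> (norm (F y))\<^sup>2" for y
    using F_norm[of y] zero_le_power2[of "norm (Q y)"] by linarith
  \<comment> \<open>Each application of \<open>F\<close> gains at least the squared norm of
    \<open>Q\<close> at the current point, and this gain never shrinks along the orbit, since
    \<open>F\<close> commutes with \<open>Q\<close> and is expanding.\<close>
  have F_pow: "(norm y)\<^sup>2 + n * (norm (Q y))\<^sup>2 \<le> (norm ((F ^^ n) y))\<^sup>2" for n y
  proof (induction n arbitrary: y)
    case (Suc n)
    have "(norm y)\<^sup>2 + real (Suc n) * (norm (Q y))\<^sup>2 \<le> (norm (F y))\<^sup>2 + n * (norm (Q y))\<^sup>2"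
      using F_norm[of y] by (simp add: algebra_simps)
    also have "\<dots> \<le> (norm (F y))\<^sup>2 + n * (norm (Q (F y)))\<^sup>2"
      using F_ge[of "Q y"] by (simp add: Q_F mult_left_mono)
    also have "\<dots> \<le> (norm ((F ^^ n) (F y)))\<^sup>2"
      by (rule Suc)
    finally show ?case by (simp add: funpow_swap1)
  qed simp
  have E_mem: "E u \<in> H" if "u \<in> H" for u
    unfolding E_def by (rule HD(5)[OF that HD(6)[OF PH[OF that]]])
  have E_norm: "norm (E u) \<le> norm u" if "u \<in> H" for u
  proof -
    have "(norm (E u))\<^sup>2 = (norm u)\<^sup>2 - 2 / c * inner (P u) u + (norm (P u))\<^sup>2 / c\<^sup>2"
      unfolding E_def power2_norm_eq_inner
      by (simp add: inner_diff_left inner_diff_right inner_commute power2_eq_square algebra_simps)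
    moreover have "(norm (P u))\<^sup>2 / c\<^sup>2 \<le> inner (P u) u / c"
      using positive_op_on_norm_square_le[OF H P c that] c(1)
      by (simp add: power2_eq_square field_simps)
    moreover have "0 \<le> inner (P u) u / c"
      using positive_op_onD(2)[OF P that] c(1) by (simp add: Re_cinner)
    ultimately have "(norm (E u))\<^sup>2 \<le> (norm u)\<^sup>2" by simp
    then show ?thesis by (rule power2_le_imp_le) simp
  qed
  have E_pow: "(E ^^ n) x \<in> H \<and> norm ((E ^^ n) x) \<le> norm x \<and> (F ^^ n) (D x) = D ((E ^^ n) x)" for n
  proof (induction n)
    case (Suc n)
    let ?u = "(E ^^ n) x"
    have u: "?u \<in> H" using Suc by simp
    \<comment> \<open>The minus sign in \<open>RD\<close> turns the expanding \<open>F\<close> into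
      the contraction \<open>E\<close>.\<close>
    have "F (D ?u) = D (E ?u)"
      by (simp add: F_def Q_def E_def RD u D_diff D_scale HD(6) PH)
    with Suc E_mem[OF u] E_norm[OF u] show ?case by simp
  qed (simp add: x)
  have "norm (Q (D x)) = 0"
  proof (rule ccontr)
    assume "norm (Q (D x)) \<noteq> 0"
    then have pos: "0 < (norm (Q (D x)))\<^sup>2" by simp
    obtain n :: nat where n: "(\<bar>B\<bar> * norm x)\<^sup>2 < n * (norm (Q (D x)))\<^sup>2"
      using reals_Archimedean3[OF pos] by blast
    have "norm (D ((E ^^ n) x)) \<le> \<bar>B\<bar> * norm ((E ^^ n) x)"
      using order_trans[OF D_bound mult_right_mono[OF abs_ge_self norm_ge_zero]] E_pow by blast
    also have "\<dots> \<le> \<bar>B\<bar> * norm x"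
      using E_pow by (intro mult_left_mono) auto
    finally have "(norm ((F ^^ n) (D x)))\<^sup>2 \<le> (\<bar>B\<bar> * norm x)\<^sup>2"
      using E_pow by (intro power_mono) auto
    with F_pow[of "D x" n] n zero_le_power2[of "norm (D x)"] show False by linarith
  qed
  then show ?thesis using c(1) by (simp add: Q_def)
qed

text \<open>On \<open>H\<close>, \<open>R (R - P) = P P - R P = - (R - P) P\<close>, which is the
  hypothesis of \<open>positive_sylvester\<close> for \<open>D = R - P\<close>.\<close>

lemma positive_sqrt_restrict:
  assumes H: "closed_csubspace H" and P: "positive_op_on H P" and R: "positive_op_on UNIV R"
    and sq: "\<And>x. x \<in> H \<Longrightarrow> R (R x) = P (P x)"
    and x: "x \<in> H"
  shows "R x = P x"
proof -
  note Pb = positive_op_onD(1)[OF P] and Rb = positive_op_onD(1)[OF R]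
  note R_lin = linear_simps[OF bounded_op_on_UNIV_bounded_linear[OF Rb]]
  have P_scale: "P (r *\<^sub>R y) = r *\<^sub>R P y" if "y \<in> H" for r y
    using bounded_op_onD(3)[OF Pb that, of "complex_of_real r"] by (simp add: scaleC_of_real)
  obtain c where c: "c > 0" "\<And>x. x \<in> H \<Longrightarrow> norm (P x) \<le> c * norm x"
    by (rule bounded_op_on_bound[OF Pb]) blast
  obtain e where e: "e > 0" "\<And>x. norm (R x) \<le> e * norm x"
    by (rule bounded_op_on_bound[OF Rb]) auto
  have null: "R (R y - P y) = 0" if "y \<in> H" for y
  proof (rule positive_sylvester[OF H P R _ _ _ _ that, where D = "\<lambda>y. R y - P y" and B = "e + c"])
    show "norm (R y - P y) \<le> (e + c) * norm y" if "y \<in> H" for y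
      using norm_triangle_ineq4[of "R y" "P y"] c(2)[OF that] e(2)[of y]
      by (simp add: algebra_simps)
  qed (auto simp: R_lin bounded_op_on_diff[OF Pb H] P_scale sq scaleR_diff_right)
  have RP: "R (P x) = P (P x)"
    using null[OF x] sq[OF x] by (simp add: R_lin)
  have symR: "cinner (R u) v = cinner u (R v)" for u v
    using positive_op_on_symmetric[OF closed_csubspace_UNIV R] by simp
  have Px: "P x \<in> H" using x by (rule bounded_op_onD(1)[OF Pb])
  \<comment> \<open>From \<open>R D = 0\<close> to \<open>D = 0\<close>: symmetry moves
    \<open>R\<close> across, and \<open>RP\<close> makes the remaining two terms cancel.\<close>
  have "cinner (R x - P x) (R x - P x) =
      cinner x (R (R x - P x)) - cinner (R (P x)) x + cinner (P x) (P x)"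
    by (simp add: cinner_diff_left cinner_diff_right symR R_lin)
  also have "\<dots> = 0"
    using positive_op_on_symmetric[OF H P Px x] by (simp add: null[OF x] RP)
  finally show ?thesis by simp
qed

section \<open>Commutation and null spaces of tuples\<close>

lemma cinner_sum_adj_on:
  assumes S: "closed_csubspace S" and A: "op_tuple_on S d A" and x: "x \<in> S" and y: "y \<in> S"
  shows "cinner (sum_adj_on S d A x) y = (\<Sum>j=1..d. cinner (A j x) (A j y))"
  unfolding sum_adj_on_def cinner_sum_left
proof (rule sum.cong)
  fix j assume "j \<in> {1..d}"
  then have "bounded_op_on S (A j)" using A by (simp add: op_tuple_on_def)
  then show "cinner (adjoint_on S (A j) (A j x)) y = cinner (A j x) (A j y)"
    using x y by (simp add: cinner_adjoint_on_left[OF S] bounded_op_onD(1))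
qed simp

lemma normal_tuple_sum_adj_commute:
  assumes N: "normal_tuple_on UNIV d N" and k: "k \<in> {1..d}"
  shows "N k (sum_adj_on UNIV d N x) = sum_adj_on UNIV d N (N k x)"
proof -
  have b: "bounded_op_on UNIV (N j)" if "j \<in> {1..d}" for j
    using N that by (simp add: normal_tuple_on_def normal_op_on_def)
  have "N k (adjoint_on UNIV (N j) y) = adjoint_on UNIV (N j) (N k y)" if j: "j \<in> {1..d}" for j y
  proof (rule fuglede[OF b[OF j] bounded_op_on_adjoint_on[OF closed_csubspace_UNIV b[OF j]] b[OF k]])
    show "cinner (N j x) y = cinner x (adjoint_on UNIV (N j) y)" for x y
      using cinner_adjoint_on[OF closed_csubspace_UNIV b[OF j]] by simp
    show "N j (adjoint_on UNIV (N j) x) = adjoint_on UNIV (N j) (N j x)" for x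
      using N j by (simp add: normal_tuple_on_def normal_op_on_def)
    show "N k (N j x) = N j (N k x)" for x
      using N j k by (simp add: normal_tuple_on_def)
  qed
  moreover have "N k (N j x) = N j (N k x)" if "j \<in> {1..d}" for j
    using N that k by (simp add: normal_tuple_on_def)
  ultimately show ?thesis
    unfolding sum_adj_on_def
    by (simp add: linear_sum[OF bounded_linear.linear[OF bounded_op_on_UNIV_bounded_linear[OF b[OF k]]]])
qed

lemma closed_csubspace_column_null_on:
  assumes S: "closed_csubspace S" and A: "op_tuple_on S d A"
  shows "closed_csubspace (column_null_on S d A)"
proof -
  note SD = closed_csubspaceD[OF S]
  have b: "bounded_op_on S (A k)" if "k \<in> {1..d}" for k
    using A that by (simp add: op_tuple_on_def)
  have "closed (null_on S (A k))" if k: "k \<in> {1..d}" for k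
  proof -
    have "closed (S \<inter> A k -` {0})"
      using bounded_op_on_continuous[OF b[OF k] S] SD(1) by (rule continuous_closed_preimage) simp
    moreover have "S \<inter> A k -` {0} = null_on S (A k)"
      by (auto simp: null_on_def)
    ultimately show ?thesis by simp
  qed
  then have "closed (column_null_on S d A)"
    unfolding column_null_on_def using SD(1) by (intro closed_Int closed_INT) auto
  moreover have "0 \<in> column_null_on S d A"
    using SD(2) bounded_op_on_zero[OF b S] by (auto simp: column_null_on_def null_on_def)
  moreover have "x + y \<in> column_null_on S d A"
    if "x \<in> column_null_on S d A" "y \<in> column_null_on S d A" for x y
    using that SD(3) bounded_op_onD(2)[OF b] by (auto simp: column_null_on_def null_on_def)
  moreover have "a *\<^sub>C x \<in> column_null_on S d A" if "x \<in> column_null_on S d A" for a x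
    using that SD(4) bounded_op_onD(3)[OF b] by (auto simp: column_null_on_def null_on_def)
  ultimately show ?thesis
    unfolding closed_csubspace_def by blast
qed

text \<open>The component of \<open>z\<close> orthogonal to \<open>M\<close> lies in the complement
  of \<open>M\<close>, hence of \<open>Z\<close>; so it is orthogonal to \<open>z\<close> and
  therefore to itself. Riesz on \<open>M\<close> provides the projection \<open>m\<close>.\<close>

lemma ocompl_subset_imp_subset:
  assumes S: "closed_csubspace S" and M: "closed_csubspace M" "M \<subseteq> S"
    and Z: "Z \<subseteq> S" and sub: "ocompl S M \<subseteq> ocompl S Z"
  shows "Z \<subseteq> M"
proof
  fix z assume z: "z \<in> Z"
  obtain m where m: "m \<in> M" "\<And>y. y \<in> M \<Longrightarrow> cinner y z = cinner y m"
    by (rule riesz[of M "\<lambda>y. cinner y z" "norm z"])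
      (use M in \<open>auto simp: cinner_add_left cinner_scaleC_left norm_cinner_le mult.commute[of "norm z"]\<close>)
  have orth: "cinner y (z - m) = 0" if "y \<in> M" for y
    using m(2)[OF that] by (simp add: cinner_diff_right)
  have orth': "cinner (z - m) y = 0" if "y \<in> M" for y
    using orth[OF that] cinner_commute[of "z - m" y] by simp
  have "z - m \<in> S"
    using z Z m(1) M(2) closed_csubspaceD(5)[OF S] by blast
  then have "z - m \<in> ocompl S Z"
    using orth' sub by (auto simp: ocompl_def)
  then have "cinner (z - m) z = 0"
    using z by (simp add: ocompl_def)
  then have "cinner (z - m) (z - m) = 0"
    using orth'[OF m(1)] by (simp add: cinner_diff_right)
  then show "z \<in> M" using m(1) by simp
qed

text \<open>The polar decomposition equates initial spaces, that is, complements; complementing once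
  more shows that every \<open>U k\<close> kills the null space of \<open>Q\<close>.\<close>

lemma null_on_subset_column_null_on:
  assumes S: "closed_csubspace S" and pol: "spherical_polar_decomposition S d A U Q"
  shows "null_on S Q \<subseteq> column_null_on S d U"
proof (rule ocompl_subset_imp_subset[OF S])
  show "closed_csubspace (column_null_on S d U)"
    using pol by (intro closed_csubspace_column_null_on S)
      (simp add: spherical_polar_decomposition_def column_partial_isometry_on_def)
qed (use pol in \<open>auto simp: spherical_polar_decomposition_def column_null_on_def null_on_def\<close>)

lemma oproj_eq_self:
  assumes S: "closed_csubspace S" and x: "x \<in> S"
  shows "oproj S x = x"
  unfolding oproj_def
proof (rule the_equality)
  fix y assume y: "y \<in> S \<and> (\<forall>z\<in>S. cinner (x - y) z = 0)"
  then have "cinner (x - y) (x - y) = 0"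
    using x closed_csubspaceD(5)[OF S] by blast
  then show "y = x" by simp
qed (simp add: x)

theorem theorem3p2:
  fixes H :: "'k::complex_hilbert set"
    and d :: nat
    and T V N W :: "nat \<Rightarrow> 'k \<Rightarrow> 'k"
    and P R :: "'k \<Rightarrow> 'k"
  assumes "closed_csubspace H"
    and "spherically_quasinormal_on H d T"
    and "pure_on H d T"
    and "spherical_polar_decomposition H d T V P"
    and "minimal_normal_extension H UNIV d T N"
    and "spherical_polar_decomposition UNIV d N W R"
  shows "(\<forall>k\<in>{1..d}. \<forall>x\<in>H. V k x = oproj H (W k x)) \<and> (\<forall>x\<in>H. P x = oproj H (R x))"
proof -
  note H = assms(1) and polT = assms(4) and polN = assms(6)
  have tupT: "op_tuple_on H d T"
    and comT: "\<And>k x. k \<in> {1..d} \<Longrightarrow> x \<in> H \<Longrightarrow> T k (sum_adj_on H d T x) = sum_adj_on H d T (T k x)"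
    using assms(2) by (auto simp: spherically_quasinormal_on_def)
  have normN: "normal_tuple_on UNIV d N"
    and ext: "\<And>k x. k \<in> {1..d} \<Longrightarrow> x \<in> H \<Longrightarrow> N k x = T k x"
    using assms(5) by (auto simp: minimal_normal_extension_def normal_extension_def)
  have tupN: "op_tuple_on UNIV d N"
    using normN by (auto simp: op_tuple_on_def normal_tuple_on_def normal_op_on_def)
  have P: "positive_op_on H P" and PP: "\<And>x. x \<in> H \<Longrightarrow> sum_adj_on H d T x = P (P x)"
    using polT by (auto simp: spherical_polar_decomposition_def sqrt_op_on_def)
  have R: "positive_op_on UNIV R" and RR: "\<And>x. sum_adj_on UNIV d N x = R (R x)"
    using polN by (auto simp: spherical_polar_decomposition_def sqrt_op_on_def)
  note Pb = positive_op_onD(1)[OF P]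
  note PH = bounded_op_onD(1)[OF Pb]
  have TH: "T k x \<in> H" if "k \<in> {1..d}" "x \<in> H" for k x
    using tupT that by (auto simp: op_tuple_on_def bounded_op_onD(1))
  have RR_cinner: "cinner (R (R x)) y = (\<Sum>j=1..d. cinner (N j x) (N j y))" for x y
    using cinner_sum_adj_on[OF closed_csubspace_UNIV tupN, of x y] by (simp add: RR)
  have PP_cinner: "cinner (P (P x)) y = (\<Sum>j=1..d. cinner (T j x) (T j y))"
    if "x \<in> H" "y \<in> H" for x y
    using cinner_sum_adj_on[OF H tupT that] by (simp add: PP that)
  have RR_PP: "cinner (R (R x)) y = cinner (P (P x)) y" if "x \<in> H" "y \<in> H" for x y
    using that by (simp add: RR_cinner PP_cinner ext)

  have sq: "R (R x) = P (P x)" if x: "x \<in> H" for x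
  proof -
    let ?r = "R (R x)" and ?p = "P (P x)"
    have p: "?p \<in> H" using x PH by blast
    \<comment> \<open>Commutation puts the second square next to \<open>N j x = T j x\<close>, a
      vector of \<open>H\<close>, where \<open>RR_PP\<close> replaces it by the square of
      \<open>P\<close>; quasinormality then undoes the move for \<open>P\<close>.\<close>
    have "cinner ?r ?r = (\<Sum>j=1..d. cinner (N j x) (R (R (N j x))))"
      unfolding RR_cinner[of x ?r]
      using normal_tuple_sum_adj_commute[OF normN] by (intro sum.cong) (auto simp: RR)
    also have "\<dots> = (\<Sum>j=1..d. cinner (T j x) (P (P (T j x))))"
    proof (rule sum.cong)
      fix j assume j: "j \<in> {1..d}"
      have "cinner (R (R (T j x))) (T j x) = cinner (P (P (T j x))) (T j x)"
        using j x by (intro RR_PP TH)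
      then show "cinner (N j x) (R (R (N j x))) = cinner (T j x) (P (P (T j x)))"
        unfolding ext[OF j x] by (metis cinner_commute)
    qed simp
    also have "\<dots> = (\<Sum>j=1..d. cinner (T j x) (T j ?p))"
      using comT x TH by (intro sum.cong) (auto simp: PP)
    also have "\<dots> = cinner ?p ?p"
      using x p by (simp add: PP_cinner)
    finally have "cinner ?r ?r = cinner ?p ?p" .
    moreover have rp: "cinner ?r ?p = cinner ?p ?p"
      using RR_PP[OF x p] .
    moreover have "cinner ?p ?r = cinner ?p ?p"
      using rp by (metis cinner_commute)
    ultimately have "cinner (?r - ?p) (?r - ?p) = 0"
      by (simp add: cinner_diff_left cinner_diff_right)
    then show ?thesis by simp
  qed
  have RP: "R x = P x" if "x \<in> H" for x
    by (rule positive_sqrt_restrict[OF H P R sq that])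

  \<comment> \<open>The vector representing \<open>x \<mapsto> cinner (V k x - W k x) w\<close> on \<open>H\<close> is orthogonal to the range
     of \<open>P\<close>, hence lies in the null space of \<open>P\<close>, where both \<open>V k\<close> and \<open>W k\<close> vanish.\<close>
  have VW: "V k x = W k x" if k: "k \<in> {1..d}" and x: "x \<in> H" for k x
  proof -
    have Vb: "bounded_op_on H (V k)" and Wb: "bounded_op_on UNIV (W k)"
      using polT polN k
      by (auto simp: spherical_polar_decomposition_def column_partial_isometry_on_def op_tuple_on_def)
    obtain c where c: "c > 0" "\<And>x. x \<in> H \<Longrightarrow> norm (V k x) \<le> c * norm x"
      by (rule bounded_op_on_bound[OF Vb]) blast
    obtain e where e: "e > 0" "\<And>x. norm (W k x) \<le> e * norm x"
      by (rule bounded_op_on_bound[OF Wb]) auto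
    \<comment> \<open>The test vector ranges over the whole space, since \<open>W k x\<close> is not
      yet known to lie in \<open>H\<close>.\<close>
    have "cinner (V k x - W k x) w = 0" for w
    proof -
      let ?f = "\<lambda>x. cinner (V k x - W k x) w"
      have bound: "cmod (?f x) \<le> (c + e) * norm w * norm x" if "x \<in> H" for x
      proof -
        have "norm (V k x - W k x) \<le> (c + e) * norm x"
          using norm_triangle_ineq4[of "V k x" "W k x"] c(2)[OF that] e(2)[of x]
          by (simp add: algebra_simps)
        from order_trans[OF norm_cinner_le mult_right_mono[OF this norm_ge_zero]]
        show ?thesis by (simp add: mult_ac)
      qed
      obtain b where b: "b \<in> H" "\<And>x. x \<in> H \<Longrightarrow> ?f x = cinner x b"
        by (rule riesz[of H ?f "(c + e) * norm w"])
          (use H bound in \<open>auto simp: bounded_op_onD[OF Vb] bounded_op_onD[OF Wb] cinner_add_left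
            cinner_diff_left cinner_scaleC_left algebra_simps\<close>)
      have "P b = 0"
      proof (rule cinner_left_eqI[OF H PH[OF b(1)] closed_csubspaceD(2)[OF H]])
        fix z assume z: "z \<in> H"
        have "V k (P z) = T k z" "W k (R z) = N k z"
          using polT polN k z by (auto simp: spherical_polar_decomposition_def)
        then have "cinner (P z) b = 0"
          using b(2)[OF PH[OF z]] by (simp add: RP z ext[OF k z])
        then have "cinner b (P z) = 0"
          using cinner_commute[of b "P z"] by simp
        then show "cinner (P b) z = cinner 0 z"
          using positive_op_on_symmetric[OF H P b(1) z] by simp
      qed
      then have "b \<in> null_on H P" "b \<in> null_on UNIV R"
        using b(1) RP[OF b(1)] by (auto simp: null_on_def)
      then have "V k b = 0" "W k b = 0"
        using null_on_subset_column_null_on[OF H polT]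
          null_on_subset_column_null_on[OF closed_csubspace_UNIV polN] k
        by (auto simp: column_null_on_def null_on_def)
      \<comment> \<open>The functional at its own representing vector is
        \<open>cinner b b\<close>.\<close>
      then have "b = 0"
        using b(2)[OF b(1)] by simp
      then show ?thesis using b(2)[OF x] by simp
    qed
    then have "V k x - W k x = 0"
      using cinner_eq_zero_iff by blast
    then show ?thesis by simp
  qed
  have "V k x \<in> H" if "k \<in> {1..d}" "x \<in> H" for k x
    using polT that by (auto simp: spherical_polar_decomposition_def
        column_partial_isometry_on_def op_tuple_on_def bounded_op_onD(1))
  \<comment> \<open>On \<open>H\<close> both \<open>R\<close> and \<open>W k\<close> now take values
    in \<open>H\<close>, so the projection acts as the identity.\<close>
  then show ?thesis
    by (simp add: RP oproj_eq_self[OF H] PH flip: VW)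
qed

end
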